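(* Let $n\ge 1$. A rational B\'ezier parametrisation of degree $n$ with complex control polygon $\{z_0,\ldots,z_n\}$ and complex weights $\{\omega_0,\ldots,\omega_n\}$ is irreducible if and only if $$\left|\begin{array}{c} T\left(\tilde\omega_{0}z_{0},\ldots,\tilde\omega_{n}z_{n};n\right)\\ T\left(\tilde\omega_{0},\ldots,\tilde\omega_{n};n\right) \end{array}\right|\neq0,$$ where $\tilde\omega_j=\binom{n}{j}\omega_j$ for $j=0,\ldots,n$.
   Context: The Bernstein polynomials of degree $n$ are $B^n_j(t)=\binom{n}{j}t^j(1-t)^{n-j}$, $j=0,\ldots,n$. The rational B\'ezier parametrisation of degree $n$ with complex control polygon $\{z_0,\ldots,z_n\}\subset\mathbb{C}$ and complex weights $\{\omega_0,\ldots,\omega_n\}\subset\mathbb{C}$, where at least $\omega_0$ and $\omega_n$ are non-zero, is $$c(t)=\frac{p(t)}{q(t)}=\frac{\sum_{j=0}^n\omega_j z_j B^n_j(t)}{\sum_{j=0}^n\omega_j B^n_j(t)},\quad t\in[0,1].$$ A complex rational parametrisation $c(t)=p(t)/q(t)$ is irreducible if and only if the polynomials $p(t)$ and $q(t)$ are relatively prime; this means that it cannot be further simplified by cancellation of common complex polynomial factors and the degree of the parametrisation is the lowest possible. For a list $x_0,\ldots,x_k$ of complex numbers and an integer $l\ge1$, $T(x_0,\ldots,x_k;l)$ denotes the matrix with $l$ rows and $k+l$ columns whose $i$-th row is $(0,\ldots,0,x_0,x_1,\ldots,x_k,0,\ldots,0)$ with $i-1$ leading zeros, $i=1,\ldots,l$;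 i.e. its $(i,j)$ entry is $x_{j-i}$ if $0\le j-i\le k$ and $0$ otherwise. The determinant above is that of the $2n\times 2n$ matrix obtained by stacking the first block on top of the second.
   Formalization: Irreducible is taken to mean that p and q are relatively prime and also that n is the lowest possible degree of the parametrisation; relative primality alone makes the claim false (n=1, z_0=z_1, equal weights: p, q coprime, determinant 0). *)

theory Defs
  imports
    "Jordan_Normal_Form.Determinant"
    "HOL-Computational_Algebra.Polynomial_Factorial"
    "HOL-Computational_Algebra.Field_as_Ring"
begin

definition bernstein_poly :: "nat \<Rightarrow> nat \<Rightarrow> complex poly" where
  "bernstein_poly n j = smult (of_nat (n choose j)) ([:0, 1:] ^ j * [:1, -1:] ^ (n - j))"

lemma poly_bernstein_poly:
  "poly (bernstein_poly n j) t = of_nat (n choose j) * t ^ j * (1 - t) ^ (n - j)"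
  by (simp add: bernstein_poly_def)

definition bezier_num :: "nat \<Rightarrow> (nat \<Rightarrow> complex) \<Rightarrow> (nat \<Rightarrow> complex) \<Rightarrow> complex poly" where
  "bezier_num n z \<omega> = (\<Sum>j\<le>n. smult (\<omega> j * z j) (bernstein_poly n j))"

definition bezier_den :: "nat \<Rightarrow> (nat \<Rightarrow> complex) \<Rightarrow> complex poly" where
  "bezier_den n \<omega> = (\<Sum>j\<le>n. smult (\<omega> j) (bernstein_poly n j))"

(* The pair (p, q) is a parametrisation p/q of nominal degree n.  Irreducible means that
   p and q have no common factor and that n is the lowest possible degree among all
   representations p'/q' of the same rational function.  The second condition is not
   implied by coprimality alone, because the Bernstein form of degree n may have
   degree p < n and degree q < n (the degree-elevated case): for n = 1, z 0 = z 1 and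
   equal weights 1 one gets p = [:z 0:] and q = 1, which are coprime although the constant
   curve has a parametrisation of degree 0.  Equality of p/q and p'/q' is cross-multiplied
   since q may vanish at some parameters. *)
definition irreducible_param :: "nat \<Rightarrow> complex poly \<Rightarrow> complex poly \<Rightarrow> bool" where
  "irreducible_param n p q \<longleftrightarrow>
     coprime p q \<and>
     (\<forall>p' q'. q' \<noteq> 0 \<and> p * q' = p' * q \<longrightarrow> n \<le> max (degree p') (degree q'))"

lemma irreducible_param_iff_coprime:
  assumes q: "q \<noteq> 0" and n: "max (degree p) (degree q) = n"
  shows "irreducible_param n p q \<longleftrightarrow> coprime p q"
proof
  assume cop: "coprime p q"
  have "n \<le> max (degree p') (degree q')" if q': "q' \<noteq> 0" and eq: "p * q' = p' * q" for p' q'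
  proof -
    have "q dvd p * q'" by (simp add: eq)
    then have "q dvd q'"
      using cop coprime_dvd_mult_right_iff[of q p q'] by (simp add: coprime_commute)
    then obtain r where r: "q' = q * r" by (rule dvdE)
    with q' have r0: "r \<noteq> 0" by auto
    have "q * p' = q * (p * r)" using eq unfolding r by (metis mult.assoc mult.commute)
    then have p': "p' = p * r" using q by auto
    have "degree q \<le> degree q'" using r r0 q by (simp add: degree_mult_eq)
    moreover have "degree p \<le> degree p'" using p' r0 by (cases "p = 0") (simp_all add: degree_mult_eq)
    ultimately show ?thesis using n by linarith
  qed
  then show "irreducible_param n p q" using cop by (auto simp: irreducible_param_def)
qed (simp add: irreducible_param_def)

(* T(x_0, ..., x_k; l), with rows and columns indexed from 0. *)
definition toeplitz_band :: "nat \<Rightarrow> (nat \<Rightarrow> complex) \<Rightarrow> nat \<Rightarrow> complex mat" where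
  "toeplitz_band k x l =
     mat l (k + l) (\<lambda>(i, j). if i \<le> j \<and> j - i \<le> k then x (j - i) else 0)"

end

theory Submission
  imports Defs "HOL-Computational_Algebra.Fundamental_Theorem_Algebra"
begin

text \<open>
  Write \<open>x\<^sub>j\<close> and \<open>y\<^sub>j\<close> for the entries of the two bands, so that the Bezier numerator
  and denominator are \<open>p(t) = \<Sum> x\<^sub>j t\<^sup>j (1 - t)\<^sup>n\<^sup>-\<^sup>j\<close> and
  \<open>q(t) = \<Sum> y\<^sub>j t\<^sup>j (1 - t)\<^sup>n\<^sup>-\<^sup>j\<close>. Let \<open>P(s) = \<Sum> x\<^sub>j s\<^sup>j\<close> and
  \<open>Q(s) = \<Sum> y\<^sub>j s\<^sup>j\<close>. The determinant is, up to the order of rows and columns, the resultant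
  of \<open>P\<close> and \<open>Q\<close> taken with nominal degrees \<open>n\<close>, while irreducibility is about \<open>p\<close> and \<open>q\<close>.
  The proof passes through the coprimality of \<open>P\<close> and \<open>Q\<close>.

  The two pairs are related by the projective change of parameter \<open>s = t / (1 - t)\<close>, since
  \<open>p(t) = (1 - t)\<^sup>n P(t / (1 - t))\<close>. It matches common roots \<open>t \<noteq> 1\<close> of \<open>p, q\<close> with common
  roots \<open>s \<noteq> -1\<close> of \<open>P, Q\<close>. Two points remain. At \<open>t = 1\<close>, where \<open>s\<close> is infinite, \<open>q\<close> takes the
  value \<open>y\<^sub>n = \<omega>\<^sub>n\<close>, which does not vanish. The point \<open>s = -1\<close> corresponds to \<open>t\<close> being infinite: \<open>P(-1)\<close> and
  \<open>Q(-1)\<close> are, up to sign, the coefficients of \<open>t\<^sup>n\<close> in \<open>p\<close> and \<open>q\<close>, and both vanish exactly when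
  \<open>p\<close> and \<open>q\<close> have degree below \<open>n\<close>. Hence the two ways of being reducible, a common factor
  and a drop of degree, together say that \<open>P\<close> and \<open>Q\<close> have a common root
  (lemma \<open>irreducible_param_bernstein_form_iff\<close>).

  For the determinant, the rows of the matrix are the coefficient vectors of \<open>s\<^sup>i P\<close> and \<open>s\<^sup>i Q\<close>
  for \<open>i < n\<close>. A common root \<open>s\<close> puts the vector of powers of \<open>s\<close> into the right kernel
  (\<open>det_eq_0_if_common_root\<close>). A vector in the left kernel is a relation
  \<open>U P + V Q = 0\<close> with \<open>U\<close> and \<open>V\<close> of degree below \<open>n = deg Q\<close>; if \<open>P\<close> and \<open>Q\<close> are coprime, then
  \<open>Q\<close> divides \<open>U\<close>, which forces \<open>U = V = 0\<close> (\<open>det_neq_0_if_coprime\<close>).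
\<close>

section \<open>Coefficient sequences read in the monomial and in the Bernstein basis\<close>

definition monomial_form :: "nat \<Rightarrow> (nat \<Rightarrow> 'a) \<Rightarrow> 'a :: comm_ring_1 poly" where
  "monomial_form n x = (\<Sum>j\<le>n. monom (x j) j)"

text \<open>
  The basis polynomials are taken without their binomial coefficients, which are absorbed into
  the sequence \<open>x\<close>. In this scaling both forms are dehomogenisations of the same binary form
  \<open>\<Sum> x\<^sub>j a\<^sup>j b\<^sup>n\<^sup>-\<^sup>j\<close>, the first at \<open>(a, b) = (s, 1)\<close> and the second at \<open>(a, b) = (t, 1 - t)\<close>.
\<close>
definition bernstein_form :: "nat \<Rightarrow> (nat \<Rightarrow> 'a) \<Rightarrow> 'a :: comm_ring_1 poly" where
  "bernstein_form n x = (\<Sum>j\<le>n. smult (x j) ([:0, 1:] ^ j * [:1, -1:] ^ (n - j)))"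

lemma bezier_num_eq_bernstein_form:
  "bezier_num n z \<omega> = bernstein_form n (\<lambda>j. of_nat (n choose j) * \<omega> j * z j)"
  by (simp add: bezier_num_def bernstein_form_def bernstein_poly_def mult_ac)

lemma bezier_den_eq_bernstein_form:
  "bezier_den n \<omega> = bernstein_form n (\<lambda>j. of_nat (n choose j) * \<omega> j)"
  by (simp add: bezier_den_def bernstein_form_def bernstein_poly_def mult_ac)

lemma coeff_monomial_form: "coeff (monomial_form n x) k = (if k \<le> n then x k else 0)"
  by (simp add: monomial_form_def coeff_sum)

lemma degree_monomial_form_le: "degree (monomial_form n x) \<le> n"
  by (rule degree_le) (simp add: coeff_monomial_form)

lemma poly_monomial_form: "poly (monomial_form n x) s = (\<Sum>j\<le>n. x j * s ^ j)"
  by (simp add: monomial_form_def poly_sum poly_monom)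

lemma poly_bernstein_form:
  "poly (bernstein_form n x) t = (\<Sum>j\<le>n. x j * (t ^ j * (1 - t) ^ (n - j)))"
  by (simp add: bernstein_form_def poly_sum)

text \<open>
  Homogeneity of degree \<open>n\<close>: the parameter \<open>(t, 1 - t)\<close> is \<open>1 - t\<close> times \<open>(t / (1 - t), 1)\<close>.
\<close>
lemma poly_bernstein_form_eq_poly_monomial_form:
  fixes t :: "'a :: field"
  assumes "t \<noteq> 1"
  shows "poly (bernstein_form n x) t = (1 - t) ^ n * poly (monomial_form n x) (t / (1 - t))"
proof -
  have "t ^ j * (1 - t) ^ (n - j) = (1 - t) ^ n * (t / (1 - t)) ^ j" if "j \<le> n" for j
    using assms that by (simp add: power_diff power_divide)
  then show ?thesis
    by (simp add: poly_bernstein_form poly_monomial_form sum_distrib_left mult_ac)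
qed

lemma poly_bernstein_form_1: "poly (bernstein_form n x) 1 = x n"
proof -
  have "poly (bernstein_form n x) 1 = (\<Sum>j\<le>n. if j = n then x j else 0)"
    unfolding poly_bernstein_form by (rule sum.cong) (auto simp: power_0_left)
  then show ?thesis by simp
qed

lemma degree_bernstein_form_le: "degree (bernstein_form n x) \<le> n"
  unfolding bernstein_form_def
proof (rule degree_sum_le)
  fix j assume "j \<in> {..n}"
  then have "j + (n - j) = n" by simp
  moreover have "degree ([:0, 1 :: 'a:] ^ j) \<le> j" "degree ([:1, - 1 :: 'a:] ^ (n - j)) \<le> n - j"
    using degree_power_le[of "[:0, 1 :: 'a:]" j] degree_power_le[of "[:1, - 1 :: 'a:]" "n - j"]
    by simp_all
  ultimately show "degree (smult (x j) ([:0, 1:] ^ j * [:1, - 1:] ^ (n - j))) \<le> n"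
    by (metis add_mono degree_mult_le degree_smult_le order_trans)
qed simp

text \<open>
  The top coefficient is the value at an infinite parameter: the direction of \<open>(t, 1 - t)\<close> tends
  to that of \<open>(1, - 1)\<close>, that is, to \<open>s = - 1\<close>. Its vanishing is a degree drop in \<open>t\<close>, and the
  other form sees it as an ordinary root.
\<close>
lemma coeff_bernstein_form_top:
  "coeff (bernstein_form n x) n = (- 1) ^ n * poly (monomial_form n x) (- 1)"
proof -
  have "coeff ([:0, 1 :: 'a:] ^ j * [:1, - 1:] ^ (n - j)) n = (- 1) ^ n * (- 1) ^ j"
    if "j \<le> n" for j
  proof -
    have "coeff ([:0, 1 :: 'a:] ^ j * [:1, - 1:] ^ (n - j)) n = (- 1) ^ (n - j)"
      using that
      by (simp add: coeff_monom_mult flip: monom_altdef[of "1 :: 'a", simplified])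
    also have "\<dots> = (- 1) ^ n * (- 1) ^ j"
      using that by (simp add: minus_one_power_iff)
    finally show ?thesis .
  qed
  then show ?thesis
    by (simp add: bernstein_form_def coeff_sum poly_monomial_form sum_distrib_left mult_ac)
qed

section \<open>Irreducibility as the absence of common roots\<close>

lemma coprime_iff_no_common_root:
  fixes p q :: "'a :: alg_closed_field poly"
  assumes "q \<noteq> 0"
  shows "coprime p q \<longleftrightarrow> (\<forall>t. poly p t \<noteq> 0 \<or> poly q t \<noteq> 0)"
proof
  assume cop: "coprime p q"
  show "\<forall>t. poly p t \<noteq> 0 \<or> poly q t \<noteq> 0"
  proof (rule ccontr)
    assume "\<not> ?thesis"
    then obtain t where "[:- t, 1:] dvd p" "[:- t, 1:] dvd q"
      by (auto simp: poly_eq_0_iff_dvd)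
    with cop have "is_unit [:- t, 1:]" by (rule coprime_common_divisor)
    then show False by (simp add: is_unit_iff_degree)
  qed
next
  assume no_root: "\<forall>t. poly p t \<noteq> 0 \<or> poly q t \<noteq> 0"
  show "coprime p q"
  proof (rule coprimeI)
    fix d assume d: "d dvd p" "d dvd q"
    have "degree d = 0"
    proof (rule ccontr)
      assume "degree d \<noteq> 0"
      then obtain t where "poly d t = 0" using alg_closed_imp_poly_has_root by blast
      with d no_root show False by (metis dvd_trans poly_eq_0_iff_dvd)
    qed
    with d(2) assms show "is_unit d" by (metis dvd_0_left is_unit_iff_degree)
  qed
qed

text \<open>
  A coprime pair is itself a representation of lowest degree, so minimality only demands that
  the nominal degree \<open>n\<close> be attained by the pair.
\<close>
lemma irreducible_param_iff:
  assumes "q \<noteq> 0" "degree p \<le> n" "degree q \<le> n"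
  shows "irreducible_param n p q \<longleftrightarrow> coprime p q \<and> (coeff p n \<noteq> 0 \<or> coeff q n \<noteq> 0)"
proof
  assume irr: "irreducible_param n p q"
  then have "n \<le> max (degree p) (degree q)"
    using assms(1) by (auto simp: irreducible_param_def)
  then have "degree p = n \<or> degree q = n" using assms(2,3) by linarith
  have "coeff p n \<noteq> 0 \<or> coeff q n \<noteq> 0"
  proof (cases "degree q = n")
    case True
    then show ?thesis using assms(1) leading_coeff_neq_0[of q] by simp
  next
    case False
    with \<open>degree p = n \<or> degree q = n\<close> assms(3) have "degree p = n" "n > 0" by auto
    then show ?thesis using leading_coeff_neq_0[of p] by (cases "p = 0") auto
  qed
  then show "coprime p q \<and> (coeff p n \<noteq> 0 \<or> coeff q n \<noteq> 0)"
    using irr by (simp add: irreducible_param_def)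
next
  assume rhs: "coprime p q \<and> (coeff p n \<noteq> 0 \<or> coeff q n \<noteq> 0)"
  then have "n \<le> degree p \<or> n \<le> degree q" by (auto dest: le_degree)
  then have "max (degree p) (degree q) = n" using assms(2,3) by linarith
  with rhs show "irreducible_param n p q"
    using irreducible_param_iff_coprime[OF assms(1)] by blast
qed

text \<open>
  The map \<open>t \<mapsto> t / (1 - t)\<close> is a bijection from the parameters \<open>t \<noteq> 1\<close> to the \<open>s \<noteq> - 1\<close>. The
  assumption on \<open>y n\<close>, which is the value of the denominator at \<open>1\<close>, rules out a common root at
  \<open>t = 1\<close>, and the degree condition supplies the missing point \<open>s = - 1\<close>.
\<close>
lemma irreducible_param_bernstein_form_iff:
  assumes "y n \<noteq> 0"
  shows "irreducible_param n (bernstein_form n x) (bernstein_form n y) \<longleftrightarrow>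
    coprime (monomial_form n x) (monomial_form n y)"
proof -
  let ?p = "bernstein_form n x" and ?q = "bernstein_form n y"
  let ?P = "monomial_form n x" and ?Q = "monomial_form n y"
  have q1: "poly ?q 1 \<noteq> 0" using assms by (simp add: poly_bernstein_form_1)
  then have q: "?q \<noteq> 0" by auto
  have Q: "?Q \<noteq> 0" using assms coeff_monomial_form[of n y n] by auto
  from q have "irreducible_param n ?p ?q \<longleftrightarrow>
      coprime ?p ?q \<and> (poly ?P (- 1) \<noteq> 0 \<or> poly ?Q (- 1) \<noteq> 0)"
    by (simp add: irreducible_param_iff degree_bernstein_form_le coeff_bernstein_form_top)
  also have "coprime ?p ?q \<longleftrightarrow> (\<forall>t. t \<noteq> 1 \<longrightarrow> poly ?p t \<noteq> 0 \<or> poly ?q t \<noteq> 0)"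
    unfolding coprime_iff_no_common_root[OF q] using q1 by metis
  also have "\<dots> \<longleftrightarrow> (\<forall>t. t \<noteq> 1 \<longrightarrow> poly ?P (t / (1 - t)) \<noteq> 0 \<or> poly ?Q (t / (1 - t)) \<noteq> 0)"
    by (simp add: poly_bernstein_form_eq_poly_monomial_form)
  also have "\<dots> \<longleftrightarrow> (\<forall>s. s \<noteq> - 1 \<longrightarrow> poly ?P s \<noteq> 0 \<or> poly ?Q s \<noteq> 0)"
  proof (intro iffI allI impI)
    fix s :: complex
    assume *: "\<forall>t. t \<noteq> 1 \<longrightarrow> poly ?P (t / (1 - t)) \<noteq> 0 \<or> poly ?Q (t / (1 - t)) \<noteq> 0"
      and s: "s \<noteq> - 1"
    from s have s': "1 + s \<noteq> 0" by (simp add: add_eq_0_iff)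
    then have "s / (1 + s) \<noteq> 1" "(s / (1 + s)) / (1 - s / (1 + s)) = s"
      by (simp_all add: field_simps)
    with * show "poly ?P s \<noteq> 0 \<or> poly ?Q s \<noteq> 0" by metis
  next
    fix t :: complex
    assume *: "\<forall>s. s \<noteq> - 1 \<longrightarrow> poly ?P s \<noteq> 0 \<or> poly ?Q s \<noteq> 0" and "t \<noteq> 1"
    then have "t / (1 - t) \<noteq> - 1" by (simp add: field_simps)
    with * show "poly ?P (t / (1 - t)) \<noteq> 0 \<or> poly ?Q (t / (1 - t)) \<noteq> 0" by blast
  qed
  also have "\<dots> \<and> (poly ?P (- 1) \<noteq> 0 \<or> poly ?Q (- 1) \<noteq> 0) \<longleftrightarrow>
      coprime ?P ?Q"
    unfolding coprime_iff_no_common_root[OF Q] by metis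
  finally show ?thesis .
qed

section \<open>The kernels of the stacked band matrix\<close>

lemma toeplitz_band_carrier [simp]: "toeplitz_band k x l \<in> carrier_mat l (k + l)"
  by (simp add: toeplitz_band_def)

text \<open>
  Reading row \<open>i\<close> as the coefficients of \<open>s\<^sup>i\<close> times the polynomial turns products of the
  matrix with vectors into polynomial arithmetic.
\<close>
lemma toeplitz_band_index:
  assumes "i < l" "j < k + l"
  shows "toeplitz_band k x l $$ (i, j) = coeff (monom 1 i * monomial_form k x) j"
  using assms by (auto simp: toeplitz_band_def coeff_monom_mult coeff_monomial_form)

lemma toeplitz_band_append_rows_index:
  assumes "i < n + n" "j < n + n"
  shows "(toeplitz_band n x n @\<^sub>r toeplitz_band n y n) $$ (i, j) =
    (if i < n then coeff (monom 1 i * monomial_form n x) j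
     else coeff (monom 1 (i - n) * monomial_form n y) j)"
  using assms toeplitz_band_carrier[of n x n] toeplitz_band_carrier[of n y n]
  by (auto simp: append_rows_def toeplitz_band_index simp del: toeplitz_band_carrier)

text \<open>
  Multiplying the row of \<open>s\<^sup>i P\<close> by the column of powers of a number evaluates that polynomial
  there, so at a common root the column is a kernel vector. It is non-zero because its first
  entry is \<open>s\<^sup>0 = 1\<close>, which exists as \<open>n \<ge> 1\<close>.
\<close>
lemma det_eq_0_if_common_root:
  assumes "n \<ge> 1" "poly (monomial_form n x) s = 0" "poly (monomial_form n y) s = 0"
  shows "det (toeplitz_band n x n @\<^sub>r toeplitz_band n y n) = 0"
proof -
  let ?A = "toeplitz_band n x n @\<^sub>r toeplitz_band n y n"
  let ?w = "vec (n + n) (\<lambda>j. s ^ j)"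
  have A: "?A \<in> carrier_mat (n + n) (n + n)" by (intro carrier_append_rows) simp_all
  have row: "(\<Sum>j<n + n. coeff (monom 1 i * monomial_form n c) j * s ^ j)
      = s ^ i * poly (monomial_form n c) s" if "i < n" for i c
  proof -
    have "degree (monom 1 i * monomial_form n c) < n + n"
      using degree_mult_le[of "monom 1 i" "monomial_form n c"]
        degree_monom_le[of "1 :: complex" i] degree_monomial_form_le[of n c] that
      by linarith
    then have "poly (monom 1 i * monomial_form n c) s
        = (\<Sum>j<n + n. coeff (monom 1 i * monomial_form n c) j * s ^ j)"
      unfolding poly_altdef by (intro sum.mono_neutral_left) (auto simp: coeff_eq_0)
    then show ?thesis by (simp add: poly_monom)
  qed
  have "?A *\<^sub>v ?w = 0\<^sub>v (n + n)"
  proof (rule eq_vecI)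
    fix i assume i: "i < dim_vec (0\<^sub>v (n + n) :: complex vec)"
    then have "(?A *\<^sub>v ?w) $ i = (\<Sum>j<n + n. ?A $$ (i, j) * s ^ j)"
      using carrier_matD[OF A] by (simp add: scalar_prod_def lessThan_atLeast0)
    also have "\<dots> = 0"
      using i assms row[of i x] row[of "i - n" y]
      by (cases "i < n") (simp_all add: toeplitz_band_append_rows_index)
    finally show "(?A *\<^sub>v ?w) $ i = 0\<^sub>v (n + n) $ i" using i by simp
  qed (simp add: carrier_matD(1)[OF A])
  moreover have "?w \<noteq> 0\<^sub>v (n + n)"
  proof
    assume "?w = 0\<^sub>v (n + n)"
    then have "?w $ 0 = 0\<^sub>v (n + n) $ 0" by simp
    with assms(1) show False by simp
  qed
  ultimately show ?thesis
    unfolding det_0_iff_vec_prod_zero[OF A] by (intro exI[of _ ?w]) simp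
qed

text \<open>
  A row dependency is a syzygy \<open>U P + V Q = 0\<close> with \<open>deg U, deg V < n\<close>. For coprime \<open>P\<close> and \<open>Q\<close>
  every syzygy is a multiple of \<open>(Q, - P)\<close>, and \<open>deg Q = n\<close> since \<open>y n\<close> is its
  leading coefficient; so the degree bound on \<open>U\<close> leaves only the trivial one.
\<close>
lemma det_neq_0_if_coprime:
  assumes "y n \<noteq> 0" and cop: "coprime (monomial_form n x) (monomial_form n y)"
  shows "det (toeplitz_band n x n @\<^sub>r toeplitz_band n y n) \<noteq> 0"
proof
  let ?A = "toeplitz_band n x n @\<^sub>r toeplitz_band n y n"
  let ?P = "monomial_form n x" and ?Q = "monomial_form n y"
  have A: "?A \<in> carrier_mat (n + n) (n + n)" by (intro carrier_append_rows) simp_all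
  assume "det ?A = 0"
  then have "det (transpose_mat ?A) = 0" using det_transpose[OF A] by simp
  then obtain v where v: "v \<in> carrier_vec (n + n)" "v \<noteq> 0\<^sub>v (n + n)"
      and ker: "transpose_mat ?A *\<^sub>v v = 0\<^sub>v (n + n)"
    using det_0_iff_vec_prod_zero[of "transpose_mat ?A" "n + n"] A by auto
  define U where "U = (\<Sum>i<n. monom (v $ i) i)"
  define V where "V = (\<Sum>i<n. monom (v $ (n + i)) i)"
  have cU: "coeff U i = (if i < n then v $ i else 0)"
    and cV: "coeff V i = (if i < n then v $ (n + i) else 0)" for i
    by (simp_all add: U_def V_def coeff_sum)
  \<comment> \<open>The kernel equations are the coefficients below \<open>2 n\<close>; the rest vanish for degree reasons.\<close>
  have "coeff (U * ?P + V * ?Q) j = 0" for j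
  proof (cases "j < n + n")
    case True
    have shift: "coeff (monom a i * R) j = a * coeff (monom 1 i * R) j" for a i and R :: "complex poly"
      by (simp add: coeff_monom_mult)
    have "coeff (U * ?P + V * ?Q) j
        = (\<Sum>i<n. v $ i * ?A $$ (i, j)) + (\<Sum>i<n. v $ (n + i) * ?A $$ (n + i, j))"
      using True
      by (simp add: U_def V_def sum_distrib_right coeff_sum toeplitz_band_append_rows_index
          shift[of "v $ _"])
    also have "\<dots> = (\<Sum>i<n + n. v $ i * ?A $$ (i, j))"
      by (simp add: lessThan_atLeast0 sum.atLeastLessThan_concat[of 0 n "n + n", symmetric]
          sum.shift_bounds_nat_ivl[of _ 0 n n, simplified] add.commute)
    also have "\<dots> = (transpose_mat ?A *\<^sub>v v) $ j"
      using True carrier_matD[OF A] carrier_vecD[OF v(1)]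
      by (simp add: scalar_prod_def lessThan_atLeast0 mult.commute)
    finally show ?thesis using True ker by simp
  next
    case False
    have "degree (R * monomial_form n c) < j" if "\<And>i. i \<ge> n \<Longrightarrow> coeff R i = 0" "n > 0"
      for R and c :: "nat \<Rightarrow> complex"
    proof -
      have "degree R \<le> n - 1" using that by (intro degree_le) auto
      then show ?thesis
        using degree_mult_le[of R "monomial_form n c"] degree_monomial_form_le[of n c] False that(2)
        by linarith
    qed
    then show ?thesis
      using cU cV by (cases "n = 0") (auto simp: coeff_eq_0 U_def V_def)
  qed
  then have rel: "U * ?P + V * ?Q = 0" by (simp add: poly_eq_iff)
  have Q: "?Q \<noteq> 0" "degree ?Q = n"
    using assms(1) degree_monomial_form_le[of n y] le_degree[of ?Q n]
    by (auto simp: coeff_monomial_form poly_eq_iff)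
  from rel have "U * ?P = ?Q * (- V)" by (simp add: algebra_simps eq_neg_iff_add_eq_0)
  then have "?Q dvd U * ?P" by simp
  then have "?Q dvd U"
    using cop by (simp add: coprime_dvd_mult_left_iff coprime_commute)
  have "U = 0"
  proof (rule ccontr)
    assume "U \<noteq> 0"
    then have "n \<le> degree U" using dvd_imp_degree_le[OF \<open>?Q dvd U\<close>] Q by simp
    then have "coeff U (degree U) = 0" by (simp add: cU)
    with \<open>U \<noteq> 0\<close> show False by simp
  qed
  with rel Q have "V = 0" by simp
  have "v = 0\<^sub>v (n + n)"
  proof (rule eq_vecI)
    fix i assume "i < dim_vec (0\<^sub>v (n + n) :: complex vec)"
    then have i: "i < n + n" by simp
    have "v $ i = (if i < n then coeff U i else coeff V (i - n))"
      using i by (auto simp: cU cV)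
    then show "v $ i = 0\<^sub>v (n + n) $ i"
      using i \<open>U = 0\<close> \<open>V = 0\<close> by simp
  qed (use v(1) in simp)
  with v(2) show False by simp
qed

theorem corollary3:
  fixes n :: nat and z \<omega> :: "nat \<Rightarrow> complex"
  assumes "n \<ge> 1" and "\<omega> 0 \<noteq> 0" and "\<omega> n \<noteq> 0"
  shows "irreducible_param n (bezier_num n z \<omega>) (bezier_den n \<omega>) \<longleftrightarrow>
    det (toeplitz_band n (\<lambda>j. of_nat (n choose j) * \<omega> j * z j) n @\<^sub>r
         toeplitz_band n (\<lambda>j. of_nat (n choose j) * \<omega> j) n) \<noteq> 0"
proof -
  let ?x = "\<lambda>j. of_nat (n choose j) * \<omega> j * z j" and ?y = "\<lambda>j. of_nat (n choose j) * \<omega> j"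
  have y: "?y n \<noteq> 0" using assms(3) by simp
  have "irreducible_param n (bezier_num n z \<omega>) (bezier_den n \<omega>) \<longleftrightarrow>
      coprime (monomial_form n ?x) (monomial_form n ?y)"
    unfolding bezier_num_eq_bernstein_form bezier_den_eq_bernstein_form
    using y by (rule irreducible_param_bernstein_form_iff)
  also have "\<dots> \<longleftrightarrow> det (toeplitz_band n ?x n @\<^sub>r toeplitz_band n ?y n) \<noteq> 0"
  proof -
    have "monomial_form n ?y \<noteq> 0" using y coeff_monomial_form[of n ?y n] by auto
    then show ?thesis
      using det_neq_0_if_coprime[of ?y n ?x] y det_eq_0_if_common_root[OF assms(1), of ?x _ ?y]
      by (auto simp: coprime_iff_no_common_root)
  qed
  finally show ?thesis .
qed

end
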